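(* Let $\alpha\in\mathbb{R}$ and let $\mathcal{X}$ be a finite state space. Let $\{q_f^i\}_{i=1}^k$ be a set of final costs for a set of $k$ $\alpha$-RLC problems, all finite-horizon (same horizon) or all first-exit (same terminal set), with the same passive dynamics $\pi_0$ and the same running cost $q(x)$. Let $w\in\mathbb{R}^k$ with $w\ge 0$ componentwise. (1) If $\alpha\neq 1$, let $z_i^{(\alpha)}$ be the optimal $z$-function of the problem with final cost $q_f^i$, $i=1,\dots,k$. Then $\sum_i w_i z_i^{(\alpha)}$ is the optimal $z$-function for the problem (with the same passive dynamics $\pi_0$ and running cost $q$) with final cost $$\frac{1}{\alpha-1}\log\left(\sum_i w_i\exp\left((\alpha-1)q_f^i\right)\right).$$ (2) If $\alpha=1$, let $v_i^{(1)}$ be the optimal value function of the problem with final cost $q_f^i$. Then $\sum_i w_i v_i^{(1)}$ is the optimal value function for the composite final cost $\sum_i w_i q_f^i$. In this case both running and final costs can be composed: if the $i$-th problem has running cost $q^i$ (in particular, if $q^i=q$ for all $i$) and final cost $q_f^i$, then $\sum_i w_i v_i^{(1)}$ is the optimal value function for the problem with passive dynamics $\pi_0$, running cost $\sum_i w_i q^i$ and final cost $\sum_i w_i q_f^i$.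
   Context: $\mathcal{X}$ is a finite set and $\mathcal{P}[\mathcal{X}]$ is the set of probability distributions on $\mathcal{X}$; $\mathrm{supp}[p]=\{x:p(x)>0\}$. The passive dynamics is a map $x\mapsto\pi_0(\cdot|x)\in\mathcal{P}[\mathcal{X}]$. For $p\in\mathcal{P}[\mathcal{X}]$ and $f:\mathcal{X}\to\mathbb{R}$: $\mathrm{E}_p[f]=\sum_x p(x)f(x)$, $\Psi^\alpha_p[f]=\alpha^{-1}\log\left(\mathrm{E}_p[\exp(\alpha f)]\right)$ for $\alpha\neq0$, and $\Psi^0_p[f]=\mathrm{E}_p[f]$. Rényi divergence of order $\alpha\in\mathbb{R}$ (in the normalization used here): for $\alpha\ne 0,1$, $\mathbb{D}_\alpha(p\|q)=\frac{1}{\alpha(\alpha-1)}\log\left(\sum_{x}p(x)^\alpha q(x)^{1-\alpha}\right)$; $\mathbb{D}_0(p\|q)=\mathrm{KL}(q\|p)$ and $\mathbb{D}_1(p\|q)=\mathrm{KL}(p\|q)$, where $\mathrm{KL}(p\|q)=\sum_x p(x)\log\frac{p(x)}{q(x)}$. It is well defined when $\mathrm{supp}[p]\cap\mathrm{supp}[q]\neq\emptyset$ if $\alpha\in(0,1)$, when $\mathrm{supp}[p]\subseteq\mathrm{supp}[q]$ if $\alpha\ge1$, and when $\mathrm{supp}[q]\subseteq\mathrm{supp}[p]$ if $\alpha\le0$. $\mathcal{U}_c(x)$ is the set of $u\in\mathcal{P}[\mathcal{X}]$ for which $\mathbb{D}_\alpha(\pi_0(\cdot|x)\|u)$ is well defined.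 In an $\alpha$-RLC (linearly solvable risk-sensitive control problem with risk parameter $\alpha$) with running cost $q$ and final cost $q_f$, the controller in state $x$ chooses the next-state distribution $u\in\mathcal{U}_c(x)$ and pays $q(x)+\mathbb{D}_\alpha(\pi_0(\cdot|x)\|u)$, with the final cost paid at the end; the objective is to minimize the risk-sensitive accumulated cost $\Psi^\alpha[\text{accumulated cost}]$. The optimal value function $v^{(\alpha)}$ is characterized by the Bellman equation: Finite horizon $T$ (FH): $v^{(\alpha)}_t(x)=q(x)+\min_{u\in\mathcal{U}_c(x)}\left\{\mathbb{D}_\alpha(\pi_0(\cdot|x)\|u)+\Psi^\alpha_{u}[v^{(\alpha)}_{t+1}]\right\}$ for $x\in\mathcal{X}$, $0\le t\le T-1$, with $v^{(\alpha)}_T(x)=q_f(x)$. First exit (FE), $\mathcal{X}$ the disjoint union of terminal states $\mathcal{T}$ and non-terminal states $\mathcal{N}$: $v^{(\alpha)}(x)=q(x)+\min_{u\in\mathcal{U}_c(x)}\left\{\mathbb{D}_\alpha(\pi_0(\cdot|x)\|u)+\Psi^\alpha_{u}[v^{(\alpha)}]\right\}$ for $x\in\mathcal{N}$, with $v^{(\alpha)}(x)=q_f(x)$ for $x\in\mathcal{T}$. For $\alpha\ne1$ the optimal $z$-function is $z^{(\alpha)}=\exp\left((\alpha-1)v^{(\alpha)}\right)$ (for each $t$ in the FH case). *)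

theory Defs
  imports "HOL-Probability.Probability_Mass_Function"
begin

text \<open>
  The state space is a finite type, distributions on it are \<^typ>\<open>'x pmf\<close>, and
  the support of a distribution is \<^const>\<open>set_pmf\<close>.
\<close>

definition expect :: "'x::finite pmf \<Rightarrow> ('x \<Rightarrow> real) \<Rightarrow> real" where
  "expect p f = (\<Sum>x\<in>UNIV. pmf p x * f x)"

definition risk :: "real \<Rightarrow> 'x::finite pmf \<Rightarrow> ('x \<Rightarrow> real) \<Rightarrow> real" where
  "risk \<alpha> p f =
     (if \<alpha> = 0 then expect p f
      else 1 / \<alpha> * ln (expect p (\<lambda>x. exp (\<alpha> * f x))))"

text \<open>
  In both definitions below the usual conventions hold on the domain of
  well-definedness: summands with a vanishing factor are zero, because
  \<open>0 * ln _ = 0\<close> and \<open>0 powr _ = 0\<close>.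
\<close>

definition KL :: "'x::finite pmf \<Rightarrow> 'x pmf \<Rightarrow> real" where
  "KL p q = (\<Sum>x\<in>UNIV. pmf p x * ln (pmf p x / pmf q x))"

definition renyi :: "real \<Rightarrow> 'x::finite pmf \<Rightarrow> 'x pmf \<Rightarrow> real" where
  "renyi \<alpha> p q =
     (if \<alpha> = 0 then KL q p
      else if \<alpha> = 1 then KL p q
      else 1 / (\<alpha> * (\<alpha> - 1)) *
           ln (\<Sum>x\<in>UNIV. pmf p x powr \<alpha> * pmf q x powr (1 - \<alpha>)))"

definition renyi_well_defined :: "real \<Rightarrow> 'x::finite pmf \<Rightarrow> 'x pmf \<Rightarrow> bool" where
  "renyi_well_defined \<alpha> p q \<longleftrightarrow>
     (if \<alpha> \<le> 0 then set_pmf q \<subseteq> set_pmf p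
      else if \<alpha> < 1 then set_pmf p \<inter> set_pmf q \<noteq> {}
      else set_pmf p \<subseteq> set_pmf q)"

definition controls :: "real \<Rightarrow> ('x::finite \<Rightarrow> 'x pmf) \<Rightarrow> 'x \<Rightarrow> 'x pmf set" where
  "controls \<alpha> \<pi>\<^sub>0 x = {u. renyi_well_defined \<alpha> (\<pi>\<^sub>0 x) u}"

text \<open>The minimum is meant literally: it has to be attained.\<close>

definition is_minimum :: "real set \<Rightarrow> real \<Rightarrow> bool" where
  "is_minimum S m \<longleftrightarrow> m \<in> S \<and> (\<forall>s\<in>S. m \<le> s)"

text \<open>
  \<open>bellman_step \<alpha> \<pi>\<^sub>0 q v' x c\<close> says that \<open>c\<close> is the right-hand side of the
  Bellman equation at the state \<open>x\<close> with continuation value \<open>v'\<close>.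
\<close>

definition bellman_step ::
    "real \<Rightarrow> ('x::finite \<Rightarrow> 'x pmf) \<Rightarrow> ('x \<Rightarrow> real) \<Rightarrow> ('x \<Rightarrow> real) \<Rightarrow> 'x \<Rightarrow> real \<Rightarrow> bool" where
  "bellman_step \<alpha> \<pi>\<^sub>0 q v' x c \<longleftrightarrow>
     (\<exists>m. is_minimum ((\<lambda>u. renyi \<alpha> (\<pi>\<^sub>0 x) u + risk \<alpha> u v') ` controls \<alpha> \<pi>\<^sub>0 x) m \<and>
          c = q x + m)"

text \<open>
  Finite horizon \<open>T\<close>. Functions of time are only relevant at times \<open>t \<le> T\<close>,
  where the Bellman equation determines the value function uniquely.
\<close>

definition fh_optimal_value ::
    "real \<Rightarrow> ('x::finite \<Rightarrow> 'x pmf) \<Rightarrow> nat \<Rightarrow> ('x \<Rightarrow> real) \<Rightarrow> ('x \<Rightarrow> real) \<Rightarrow>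
     (nat \<Rightarrow> 'x \<Rightarrow> real) \<Rightarrow> bool" where
  "fh_optimal_value \<alpha> \<pi>\<^sub>0 T q q\<^sub>f v \<longleftrightarrow>
     (\<forall>x. v T x = q\<^sub>f x) \<and>
     (\<forall>t<T. \<forall>x. bellman_step \<alpha> \<pi>\<^sub>0 q (v (Suc t)) x (v t x))"

definition fh_optimal_z ::
    "real \<Rightarrow> ('x::finite \<Rightarrow> 'x pmf) \<Rightarrow> nat \<Rightarrow> ('x \<Rightarrow> real) \<Rightarrow> ('x \<Rightarrow> real) \<Rightarrow>
     (nat \<Rightarrow> 'x \<Rightarrow> real) \<Rightarrow> bool" where
  "fh_optimal_z \<alpha> \<pi>\<^sub>0 T q q\<^sub>f z \<longleftrightarrow>
     (\<exists>v. fh_optimal_value \<alpha> \<pi>\<^sub>0 T q q\<^sub>f v \<and>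
          (\<forall>t\<le>T. \<forall>x. z t x = exp ((\<alpha> - 1) * v t x)))"

text \<open>First exit with set of terminal states \<open>Term\<close>; the non-terminal states are \<open>- Term\<close>.\<close>

definition fe_optimal_value ::
    "real \<Rightarrow> ('x::finite \<Rightarrow> 'x pmf) \<Rightarrow> 'x set \<Rightarrow> ('x \<Rightarrow> real) \<Rightarrow> ('x \<Rightarrow> real) \<Rightarrow>
     ('x \<Rightarrow> real) \<Rightarrow> bool" where
  "fe_optimal_value \<alpha> \<pi>\<^sub>0 Term q q\<^sub>f v \<longleftrightarrow>
     (\<forall>x\<in>Term. v x = q\<^sub>f x) \<and>
     (\<forall>x\<in>- Term. bellman_step \<alpha> \<pi>\<^sub>0 q v x (v x))"

definition fe_optimal_z ::
    "real \<Rightarrow> ('x::finite \<Rightarrow> 'x pmf) \<Rightarrow> 'x set \<Rightarrow> ('x \<Rightarrow> real) \<Rightarrow> ('x \<Rightarrow> real) \<Rightarrow>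
     ('x \<Rightarrow> real) \<Rightarrow> bool" where
  "fe_optimal_z \<alpha> \<pi>\<^sub>0 Term q q\<^sub>f z \<longleftrightarrow>
     (\<exists>v. fe_optimal_value \<alpha> \<pi>\<^sub>0 Term q q\<^sub>f v \<and>
          (\<forall>x. z x = exp ((\<alpha> - 1) * v x)))"

text \<open>
  Without further assumptions the first-exit Bellman equation need not have
  exactly one solution; it characterizes the value function when it does.
\<close>

definition fe_unique ::
    "real \<Rightarrow> ('x::finite \<Rightarrow> 'x pmf) \<Rightarrow> 'x set \<Rightarrow> ('x \<Rightarrow> real) \<Rightarrow> ('x \<Rightarrow> real) \<Rightarrow> bool" where
  "fe_unique \<alpha> \<pi>\<^sub>0 Term q q\<^sub>f \<longleftrightarrow> (\<exists>!v. fe_optimal_value \<alpha> \<pi>\<^sub>0 Term q q\<^sub>f v)"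

end

theory Submission imports Defs begin

text \<open>
  The control \<open>u \<propto> \<pi>\<^sub>0 exp (- v)\<close> attains the minimum in the Bellman equation for every \<open>\<alpha>\<close>;
  the lower bound is Hoelder's inequality when \<open>\<alpha> \<noteq> 0, 1\<close> and Gibbs' inequality in the two
  remaining cases. The minimal value is \<open>\<Psi>\<close> of order \<open>\<alpha> - 1\<close> under the passive dynamics, so
  the Bellman equation is affine in \<open>v\<close> if \<open>\<alpha> = 1\<close>, and otherwise linear in the \<open>z\<close>-function.
  Uniqueness transfers because the difference of two solutions of the composite
  first-exit problem solves the homogeneous linear equation: a small multiple of it, added to the
  solution of one of the component problems, gives another solution of that component problem.
\<close>

section \<open>Expectations over a finite state space\<close>

lemma expect_pos:
  fixes p :: "'x::finite pmf"
  assumes "\<And>x. 0 < f x"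
  shows "0 < expect p f"
proof -
  obtain x where "x \<in> set_pmf p"
    using set_pmf_not_empty by fast
  then have "0 < pmf p x * f x"
    by (simp add: assms pmf_positive)
  then show ?thesis
    unfolding expect_def using assms
    by (intro sum_pos2[of UNIV x]) (auto simp: less_imp_le)
qed

lemma expect_add: "expect p (\<lambda>x. f x + g x) = expect p f + expect p g"
  by (simp add: expect_def distrib_left sum.distrib)

lemma expect_diff: "expect p (\<lambda>x. f x - g x) = expect p f - expect p g"
  by (simp add: expect_def right_diff_distrib sum_subtractf)

lemma expect_cmult: "expect p (\<lambda>x. c * f x) = c * expect p f"
  by (simp add: expect_def sum_distrib_left mult_ac)

lemma expect_sum: "expect p (\<lambda>x. \<Sum>i\<in>I. f i x) = (\<Sum>i\<in>I. expect p (f i))"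
  unfolding expect_def sum_distrib_left by (rule sum.swap)

lemma expect_cong: "(\<And>x. x \<in> set_pmf p \<Longrightarrow> f x = g x) \<Longrightarrow> expect p f = expect p g"
  unfolding expect_def by (intro sum.cong) (auto simp: set_pmf_iff)

lemma expect_const: "expect (p :: 'x::finite pmf) (\<lambda>x. c) = c"
  by (simp add: expect_def sum_pmf_eq_1 flip: sum_distrib_right)

section \<open>Entropy inequalities\<close>

text \<open>Averaging \<open>ln t \<le> t - 1\<close> at \<open>t = b x / (pmf p x * B)\<close>,
  with \<open>B\<close> the total mass of \<open>b\<close>, bounds the average by the mass of
  \<open>b / B\<close> minus that of \<open>p\<close>, which is zero. The weight \<open>b\<close>
  stays unnormalised because it will be a distribution times an exponential.\<close>

lemma Gibbs_ineq:
  fixes p :: "'x::finite pmf"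
  assumes "\<And>x. 0 \<le> b x" "\<And>x. x \<in> set_pmf p \<Longrightarrow> 0 < b x"
  shows "expect p (\<lambda>x. ln (b x / pmf p x)) \<le> ln (\<Sum>x\<in>UNIV. b x)"
proof -
  define B where "B = (\<Sum>x\<in>UNIV. b x)"
  obtain y where y: "y \<in> set_pmf p"
    using set_pmf_not_empty by fast
  have B: "0 < B"
    unfolding B_def by (rule sum_pos2[of UNIV y]) (use assms y in auto)
  have "pmf p x * (ln (b x / pmf p x) - ln B) \<le> b x / B - pmf p x" for x
  proof (cases "x \<in> set_pmf p")
    case True
    then have p: "0 < pmf p x" and b: "0 < b x"
      using assms(2) by (auto simp: pmf_positive)
    have "ln (b x / pmf p x) - ln B = ln (b x / pmf p x / B)"
      using p b B by (simp add: ln_div del: divide_divide_eq_left)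
    also have "\<dots> \<le> b x / pmf p x / B - 1"
      using p b B by (intro ln_le_minus_one) simp
    finally have "pmf p x * (ln (b x / pmf p x) - ln B) \<le> pmf p x * (b x / pmf p x / B - 1)"
      using p by (intro mult_left_mono) auto
    also have "\<dots> = b x / B - pmf p x"
      using p by (simp add: field_simps)
    finally show ?thesis .
  next
    case False
    then show ?thesis
      using assms(1)[of x] B by (simp add: set_pmf_iff)
  qed
  then have "(\<Sum>x\<in>UNIV. pmf p x * (ln (b x / pmf p x) - ln B)) \<le> (\<Sum>x\<in>UNIV. b x / B - pmf p x)"
    by (rule sum_mono)
  also have "\<dots> = 0"
    using B by (simp add: sum_subtractf sum_pmf_eq_1 B_def flip: sum_divide_distrib)
  finally have "expect p (\<lambda>x. ln (b x / pmf p x) - ln B) \<le> 0"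
    by (simp add: expect_def)
  then show ?thesis
    unfolding expect_diff expect_const B_def by simp
qed

text \<open>Young's inequality for the normalised terms \<open>a x / A\<close> and
  \<open>b x / B\<close>, summed over \<open>S\<close>, gives Hoelder's inequality with exponents
  \<open>1 / s\<close> and \<open>1 / (1 - s)\<close>. The common point \<open>y\<close> keeps all
  sums positive, so that \<open>ln\<close> is monotone there.\<close>

lemma Hoelder_ln_sum:
  fixes a b :: "'x \<Rightarrow> real"
  assumes fin: "finite S" and s: "0 < s" "s < 1"
    and nonneg: "\<And>x. x \<in> S \<Longrightarrow> 0 \<le> a x" "\<And>x. x \<in> S \<Longrightarrow> 0 \<le> b x"
    and pos: "y \<in> S" "0 < a y" "0 < b y"
  shows "ln (\<Sum>x\<in>S. a x powr s * b x powr (1 - s)) \<le>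
           s * ln (\<Sum>x\<in>S. a x) + (1 - s) * ln (\<Sum>x\<in>S. b x)"
proof -
  define A where "A = (\<Sum>x\<in>S. a x)"
  define B where "B = (\<Sum>x\<in>S. b x)"
  have A: "0 < A" and B: "0 < B"
    unfolding A_def B_def using fin nonneg pos by (auto intro: sum_pos2)
  let ?c = "\<lambda>x. a x powr s * b x powr (1 - s)"
  have C: "0 < sum ?c S"
    using fin pos by (intro sum_pos2[of S y]) auto
  have "?c x / (A powr s * B powr (1 - s)) \<le> s * (a x / A) + (1 - s) * (b x / B)" if "x \<in> S" for x
  proof (cases "a x = 0 \<or> b x = 0")
    case True
    then show ?thesis
      using s nonneg[OF that] A B by auto
  next
    case False
    then have ab: "0 < a x" "0 < b x"
      using nonneg[OF that] by auto
    have "?c x / (A powr s * B powr (1 - s)) = (a x / A) powr s * (b x / B) powr (1 - s)"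
      using ab A B by (simp add: powr_divide)
    also have "\<dots> \<le> s * (a x / A) + (1 - s) * (b x / B)"
      using s ab A B by (intro Youngs_inequality_0) auto
    finally show ?thesis .
  qed
  then have "(\<Sum>x\<in>S. ?c x / (A powr s * B powr (1 - s))) \<le>
      (\<Sum>x\<in>S. s * (a x / A) + (1 - s) * (b x / B))"
    by (rule sum_mono)
  also have "\<dots> = s * (A / A) + (1 - s) * (B / B)"
    unfolding A_def B_def sum.distrib by (simp only: sum_distrib_left sum_divide_distrib)
  also have "\<dots> = 1"
    using A B by simp
  finally have "sum ?c S \<le> A powr s * B powr (1 - s)"
    using A B by (simp add: sum_divide_distrib[symmetric] divide_le_eq)
  then have "ln (sum ?c S) \<le> ln (A powr s * B powr (1 - s))"
    using C by simp
  also have "\<dots> = s * ln A + (1 - s) * ln B"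
    using A B by (simp add: ln_mult ln_powr)
  finally show ?thesis
    unfolding A_def B_def .
qed

section \<open>The minimum in the Bellman equation\<close>

text \<open>Away from 0 and 1 the claim compares \<open>\<alpha> * ln C\<close> with
  \<open>ln A + (\<alpha> - 1) * ln B\<close>, after multiplication by
  \<open>\<alpha> * (\<alpha> - 1)\<close>. Hoelder applies to whichever of the three sums
  interpolates between the other two: \<open>B\<close> for \<alpha> < 0, \<open>A\<close> for 0 <
  \<alpha> < 1, \<open>C\<close> for \<alpha> > 1.\<close>

lemma renyi_risk_lower_bound:
  fixes p u :: "'x::finite pmf"
  assumes wd: "renyi_well_defined \<alpha> p u"
  shows "risk (\<alpha> - 1) p v \<le> renyi \<alpha> p u + risk \<alpha> u v"
proof -
  define A where "A = (\<Sum>x\<in>UNIV. pmf p x powr \<alpha> * pmf u x powr (1 - \<alpha>))"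
  define B where "B = expect u (\<lambda>x. exp (\<alpha> * v x))"
  define C where "C = expect p (\<lambda>x. exp ((\<alpha> - 1) * v x))"
  \<comment> \<open>Each form of well-definedness makes the supports meet, which supplies the
    positive terms for Hoelder's inequality.\<close>
  obtain y where y: "0 < pmf p y" "0 < pmf u y"
  proof -
    have "set_pmf p \<inter> set_pmf u \<noteq> {}"
      using wd set_pmf_not_empty[of p] set_pmf_not_empty[of u]
      by (auto simp: renyi_well_defined_def split: if_splits)
    then show ?thesis
      using that by (blast intro: pmf_positive)
  qed
  consider "\<alpha> = 0" | "\<alpha> = 1" | "\<alpha> < 0" | "0 < \<alpha>" "\<alpha> < 1" | "1 < \<alpha>"
    by linarith
  then show ?thesis
  proof cases
    case 1
    have supp: "0 < pmf u x \<and> 0 < pmf p x" if "x \<in> set_pmf u" for x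
      using wd that 1 by (auto simp: renyi_well_defined_def pmf_positive)
    \<comment> \<open>Since \<open>risk (- 1) p v\<close> is minus a logarithm, Gibbs' inequality is
      applied to the negated cost, with weight \<open>pmf p x * exp (- v x)\<close>.\<close>
    have "- (KL u p + expect u v) = expect u (\<lambda>x. - (ln (pmf u x / pmf p x) + v x))"
      by (simp add: KL_def expect_def distrib_left right_diff_distrib sum_subtractf sum_negf)
    also have "\<dots> = expect u (\<lambda>x. ln (pmf p x * exp (- v x) / pmf u x))"
      by (rule expect_cong) (use supp in \<open>force simp: ln_div ln_mult\<close>)
    also have "\<dots> \<le> ln (\<Sum>x\<in>UNIV. pmf p x * exp (- v x))"
      by (rule Gibbs_ineq) (use supp in auto)
    finally show ?thesis
      using 1 by (simp add: renyi_def risk_def expect_def)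
  next
    case 2
    have supp: "0 < pmf u x \<and> 0 < pmf p x" if "x \<in> set_pmf p" for x
      using wd that 2 by (auto simp: renyi_well_defined_def pmf_positive)
    \<comment> \<open>Here \<open>risk 0 p v\<close> is the plain expectation, and the Gibbs weight
      is \<open>pmf u x * exp (v x)\<close>.\<close>
    have "expect p v - KL p u = expect p (\<lambda>x. v x - ln (pmf p x / pmf u x))"
      by (simp add: KL_def expect_def right_diff_distrib sum_subtractf)
    also have "\<dots> = expect p (\<lambda>x. ln (pmf u x * exp (v x) / pmf p x))"
      by (rule expect_cong) (use supp in \<open>force simp: ln_div ln_mult\<close>)
    also have "\<dots> \<le> ln (\<Sum>x\<in>UNIV. pmf u x * exp (v x))"
      by (rule Gibbs_ineq) (use supp in auto)
    finally show ?thesis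
      using 2 by (simp add: renyi_def risk_def expect_def)
  next
    case 3
    \<comment> \<open>With this exponent the powers of \<open>pmf p x\<close> cancel and
      \<open>pmf u x\<close> keeps exponent one, so the Hoelder product is the summand of
      \<open>B\<close>.\<close>
    define s where "s = 1 / (1 - \<alpha>)"
    have s: "0 < s" "s < 1" "\<alpha> * s + (1 - s) = 0" "(1 - \<alpha>) * s = 1" "(\<alpha> - 1) * (1 - s) = \<alpha>"
      using 3 by (auto simp: s_def field_simps)
    have supp: "0 < pmf p x" if "pmf u x \<noteq> 0" for x
      using wd that 3 by (auto simp: renyi_well_defined_def set_pmf_iff)
    have "(pmf p x powr \<alpha> * pmf u x powr (1 - \<alpha>)) powr s *
          (pmf p x * exp ((\<alpha> - 1) * v x)) powr (1 - s) = pmf u x * exp (\<alpha> * v x)" for x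
    proof (cases "pmf u x = 0")
      case False
      have "(pmf p x powr \<alpha> * pmf u x powr (1 - \<alpha>)) powr s *
          (pmf p x * exp ((\<alpha> - 1) * v x)) powr (1 - s) =
        (pmf p x powr (\<alpha> * s) * pmf p x powr (1 - s)) * pmf u x powr ((1 - \<alpha>) * s) *
          exp (((\<alpha> - 1) * (1 - s)) * v x)"
        by (simp add: powr_mult powr_powr exp_powr_real mult_ac)
      \<comment> \<open>The zeroth power of \<open>pmf p x\<close> is one only where
        \<open>pmf p x\<close> is nonzero, which the support inclusion guarantees.\<close>
      also have "\<dots> = pmf u x * exp (\<alpha> * v x)"
        using supp[OF False] unfolding s(4,5) powr_add[symmetric] s(3) by simp
      finally show ?thesis .
    qed simp
    moreover have "ln (\<Sum>x\<in>UNIV. (pmf p x powr \<alpha> * pmf u x powr (1 - \<alpha>)) powr s *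
        (pmf p x * exp ((\<alpha> - 1) * v x)) powr (1 - s)) \<le> s * ln A + (1 - s) * ln C"
      unfolding A_def C_def expect_def
      by (rule Hoelder_ln_sum[where y = y]) (use s y in auto)
    ultimately have "ln B \<le> s * ln A + (1 - s) * ln C"
      by (simp add: B_def expect_def)
    then have "(1 - \<alpha>) * ln B \<le> (1 - \<alpha>) * (s * ln A + (1 - s) * ln C)"
      using 3 by (intro mult_left_mono) auto
    also have "\<dots> = ((1 - \<alpha>) * s) * ln A + ((1 - \<alpha>) - (1 - \<alpha>) * s) * ln C"
      by (simp add: algebra_simps)
    also have "\<dots> = ln A - \<alpha> * ln C"
      unfolding s(4) by simp
    finally have "\<alpha> * ln C \<le> ln A + (\<alpha> - 1) * ln B"
      by (simp add: algebra_simps)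
    moreover have "0 < \<alpha> * (\<alpha> - 1)"
      using 3 by (simp add: zero_less_mult_iff)
    ultimately have "\<alpha> * ln C / (\<alpha> * (\<alpha> - 1)) \<le> (ln A + (\<alpha> - 1) * ln B) / (\<alpha> * (\<alpha> - 1))"
      by (intro divide_right_mono) auto
    then show ?thesis
      using 3 by (simp add: renyi_def risk_def add_divide_distrib flip: A_def B_def C_def)
  next
    case 4
    \<comment> \<open>The exponentials cancel, so Hoelder with \<open>s = \<alpha>\<close> has the
      Renyi summand as its product.\<close>
    have "(pmf p x * exp ((\<alpha> - 1) * v x)) powr \<alpha> * (pmf u x * exp (\<alpha> * v x)) powr (1 - \<alpha>)
        = pmf p x powr \<alpha> * pmf u x powr (1 - \<alpha>)" for x
    proof -
      have "exp (\<alpha> * ((\<alpha> - 1) * v x)) * exp (\<alpha> * ((1 - \<alpha>) * v x)) = 1"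
        by (simp add: algebra_simps flip: exp_add)
      then show ?thesis
        by (simp add: powr_mult exp_powr_real mult_ac)
    qed
    moreover have "ln (\<Sum>x\<in>UNIV. (pmf p x * exp ((\<alpha> - 1) * v x)) powr \<alpha> *
        (pmf u x * exp (\<alpha> * v x)) powr (1 - \<alpha>)) \<le> \<alpha> * ln C + (1 - \<alpha>) * ln B"
      unfolding B_def C_def expect_def
      by (rule Hoelder_ln_sum[where y = y]) (use 4 y in auto)
    ultimately have "ln A + (\<alpha> - 1) * ln B \<le> \<alpha> * ln C"
      by (simp add: A_def algebra_simps)
    \<comment> \<open>The Hoelder bound points the other way in this range; dividing by a negative
      factor restores the direction.\<close>
    moreover have "\<alpha> * (\<alpha> - 1) < 0"
      using 4 by (simp add: mult_less_0_iff)
    ultimately have "\<alpha> * ln C / (\<alpha> * (\<alpha> - 1)) \<le> (ln A + (\<alpha> - 1) * ln B) / (\<alpha> * (\<alpha> - 1))"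
      by (intro divide_right_mono_neg) auto
    then show ?thesis
      using 4 by (simp add: renyi_def risk_def add_divide_distrib flip: A_def B_def C_def)
  next
    case 5
    \<comment> \<open>Now the powers of \<open>pmf u x\<close> cancel and \<open>pmf p x\<close>
      keeps exponent one, which gives the summand of \<open>C\<close>.\<close>
    define s where "s = 1 / \<alpha>"
    have s: "0 < s" "s < 1" "\<alpha> * s = 1" "(1 - \<alpha>) * s + (1 - s) = 0" "\<alpha> * (1 - s) = \<alpha> - 1"
      using 5 by (auto simp: s_def field_simps)
    have supp: "0 < pmf u x" if "pmf p x \<noteq> 0" for x
      using wd that 5 by (auto simp: renyi_well_defined_def set_pmf_iff)
    have "(pmf p x powr \<alpha> * pmf u x powr (1 - \<alpha>)) powr s *
          (pmf u x * exp (\<alpha> * v x)) powr (1 - s) = pmf p x * exp ((\<alpha> - 1) * v x)" for x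
    proof (cases "pmf p x = 0")
      case False
      have "(pmf p x powr \<alpha> * pmf u x powr (1 - \<alpha>)) powr s *
          (pmf u x * exp (\<alpha> * v x)) powr (1 - s) =
        pmf p x powr (\<alpha> * s) * (pmf u x powr ((1 - \<alpha>) * s) * pmf u x powr (1 - s)) *
          exp ((\<alpha> * (1 - s)) * v x)"
        by (simp add: powr_mult powr_powr exp_powr_real mult_ac)
      also have "\<dots> = pmf p x * exp ((\<alpha> - 1) * v x)"
        using supp[OF False] unfolding s(3,5) powr_add[symmetric] s(4) by simp
      finally show ?thesis .
    qed simp
    moreover have "ln (\<Sum>x\<in>UNIV. (pmf p x powr \<alpha> * pmf u x powr (1 - \<alpha>)) powr s *
        (pmf u x * exp (\<alpha> * v x)) powr (1 - s)) \<le> s * ln A + (1 - s) * ln B"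
      unfolding A_def B_def expect_def
      by (rule Hoelder_ln_sum[where y = y]) (use s y in auto)
    ultimately have "ln C \<le> s * ln A + (1 - s) * ln B"
      by (simp add: C_def expect_def)
    then have "\<alpha> * ln C \<le> \<alpha> * (s * ln A + (1 - s) * ln B)"
      using 5 by (intro mult_left_mono) auto
    also have "\<dots> = (\<alpha> * s) * ln A + (\<alpha> * (1 - s)) * ln B"
      by (simp only: distrib_left mult.assoc)
    also have "\<dots> = ln A + (\<alpha> - 1) * ln B"
      unfolding s(3,5) by simp
    finally have "\<alpha> * ln C / (\<alpha> * (\<alpha> - 1)) \<le> (ln A + (\<alpha> - 1) * ln B) / (\<alpha> * (\<alpha> - 1))"
      using 5 by (intro divide_right_mono) auto
    then show ?thesis
      using 5 by (simp add: renyi_def risk_def add_divide_distrib flip: A_def B_def C_def)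
  qed
qed

section \<open>The exponentially tilted control\<close>

definition tilted_pmf :: "'x::finite pmf \<Rightarrow> ('x \<Rightarrow> real) \<Rightarrow> 'x pmf" where
  "tilted_pmf p v = embed_pmf (\<lambda>x. pmf p x * exp (- v x) / expect p (\<lambda>x. exp (- v x)))"

text \<open>The normaliser is positive, hence the weights are nonnegative with total mass one, the
  two conditions under which \<open>embed_pmf\<close> has the prescribed mass function.\<close>

lemma pmf_tilted:
  fixes p :: "'x::finite pmf"
  shows "pmf (tilted_pmf p v) x = pmf p x * exp (- v x) / expect p (\<lambda>x. exp (- v x))"
proof -
  have Z: "0 < expect p (\<lambda>x. exp (- v x))"
    by (rule expect_pos) simp
  have "(\<Sum>x\<in>UNIV. pmf p x * exp (- v x) / expect p (\<lambda>x. exp (- v x))) = 1"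
    using Z by (simp add: expect_def flip: sum_divide_distrib)
  then show ?thesis
    unfolding tilted_pmf_def using Z
    by (intro pmf_embed_pmf) (auto simp: nn_integral_count_space_finite sum_ennreal)
qed

text \<open>The exponential factor never vanishes. Equal supports make the tilted control admissible
  for every \<alpha>.\<close>

lemma set_tilted_pmf: "set_pmf (tilted_pmf p v) = set_pmf p"
proof -
  have "0 < expect p (\<lambda>x. exp (- v x))"
    by (rule expect_pos) simp
  then show ?thesis
    by (auto simp: set_pmf_eq pmf_tilted)
qed

text \<open>With normaliser \<open>Z\<close>, the exponential moment under \<open>u\<close> is
  \<open>C / Z\<close> and the Renyi sum is \<open>C * Z powr (\<alpha> - 1)\<close>, so
  \<open>Z\<close> cancels from the total cost. In the two KL cases the log-ratio of the
  distributions is \<open>v\<close> up to sign and a constant on the support.\<close>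

lemma renyi_risk_tilted:
  fixes p :: "'x::finite pmf"
  shows "renyi \<alpha> p (tilted_pmf p v) + risk \<alpha> (tilted_pmf p v) v = risk (\<alpha> - 1) p v"
proof -
  define Z where "Z = expect p (\<lambda>x. exp (- v x))"
  define u where "u = tilted_pmf p v"
  have Z: "0 < Z"
    unfolding Z_def by (rule expect_pos) simp
  have u: "pmf u x = pmf p x * exp (- v x) / Z" for x
    by (simp add: u_def Z_def pmf_tilted)
  have set_u: "set_pmf u = set_pmf p"
    by (simp add: u_def set_tilted_pmf)
  define C where "C = expect p (\<lambda>x. exp ((\<alpha> - 1) * v x))"
  have C: "0 < C"
    unfolding C_def by (rule expect_pos) simp
  have B: "expect u (\<lambda>x. exp (\<alpha> * v x)) = C / Z"
    unfolding C_def expect_def u sum_divide_distrib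
    by (intro sum.cong) (auto simp: algebra_simps simp flip: exp_add)
  consider "\<alpha> = 0" | "\<alpha> = 1" | "\<alpha> \<noteq> 0" "\<alpha> \<noteq> 1"
    by blast
  then have "renyi \<alpha> p u + risk \<alpha> u v = risk (\<alpha> - 1) p v"
  proof cases
    case 1
    have "KL u p + expect u v = expect u (\<lambda>x. ln (pmf u x / pmf p x) + v x)"
      unfolding expect_add by (simp add: KL_def expect_def)
    also have "\<dots> = expect u (\<lambda>x. - ln Z)"
    proof (rule expect_cong)
      fix x assume "x \<in> set_pmf u"
      then have "0 < pmf p x"
        by (simp add: set_u pmf_positive)
      then have "pmf u x / pmf p x = exp (- v x) / Z"
        by (simp add: u)
      then show "ln (pmf u x / pmf p x) + v x = - ln Z"
        using Z by (simp add: ln_div)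
    qed
    finally show ?thesis
      using 1 by (simp add: renyi_def risk_def Z_def expect_const)
  next
    case 2
    have "KL p u = expect p (\<lambda>x. v x + ln Z)"
      unfolding KL_def expect_def[symmetric]
    proof (rule expect_cong)
      fix x assume "x \<in> set_pmf p"
      then have "0 < pmf p x"
        by (simp add: pmf_positive)
      then have "pmf p x / pmf u x = exp (v x) * Z"
        using Z by (simp add: u exp_minus field_simps)
      then show "ln (pmf p x / pmf u x) = v x + ln Z"
        using Z by (simp add: ln_mult)
    qed
    \<comment> \<open>The moment of order zero is one, so \<open>risk 1 u v\<close> reduces to
      \<open>- ln Z\<close>.\<close>
    moreover have "C = 1"
      using 2 by (simp add: C_def expect_const)
    ultimately show ?thesis
      using 2 Z B by (simp add: renyi_def risk_def expect_add expect_const ln_div)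
  next
    case 3
    have "pmf p x powr \<alpha> * pmf u x powr (1 - \<alpha>) =
        pmf p x * exp ((\<alpha> - 1) * v x) * Z powr (\<alpha> - 1)" for x
    proof (cases "pmf p x = 0")
      case False
      have "pmf u x powr (1 - \<alpha>) = pmf p x powr (1 - \<alpha>) * exp ((\<alpha> - 1) * v x) * Z powr (\<alpha> - 1)"
      proof -
        have "exp (- v x) powr (1 - \<alpha>) = exp ((\<alpha> - 1) * v x)"
          by (simp add: exp_powr_real algebra_simps)
        moreover have "c / Z powr (1 - \<alpha>) = c * Z powr (\<alpha> - 1)" for c
          using powr_minus_divide[of Z "1 - \<alpha>"] by simp
        ultimately show ?thesis
          using Z unfolding u by (simp add: powr_divide powr_mult)
      qed
      moreover have "pmf p x powr \<alpha> * pmf p x powr (1 - \<alpha>) = pmf p x"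
        using False by (simp flip: powr_add)
      ultimately show ?thesis
        by simp
    qed simp
    then have A: "(\<Sum>x\<in>UNIV. pmf p x powr \<alpha> * pmf u x powr (1 - \<alpha>)) = C * Z powr (\<alpha> - 1)"
      by (simp add: C_def expect_def sum_distrib_right)
    \<comment> \<open>The \<open>ln Z\<close> terms cancel, and
      \<open>1 / (\<alpha> * (\<alpha> - 1)) + 1 / \<alpha>\<close> equals
      \<open>1 / (\<alpha> - 1)\<close>.\<close>
    have "1 / (\<alpha> * (\<alpha> - 1)) * (ln C + (\<alpha> - 1) * ln Z) + 1 / \<alpha> * (ln C - ln Z) = 1 / (\<alpha> - 1) * ln C"
      using 3 by (simp add: divide_simps) (simp add: algebra_simps)
    then show ?thesis
      using 3 C Z by (simp add: renyi_def risk_def A B ln_mult ln_div ln_powr flip: C_def)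
  qed
  then show ?thesis
    by (simp add: u_def)
qed

section \<open>Elimination of the control from the Bellman equation\<close>

lemma is_minimum_unique: "is_minimum S m \<Longrightarrow> is_minimum S m' \<longleftrightarrow> m' = m"
  by (auto simp: is_minimum_def intro: antisym)

text \<open>The lower bound holds for all admissible controls and the tilted one attains it, so the
  literal minimum exists. Later arguments see only this closed form.\<close>

lemma bellman_step_iff:
  "bellman_step \<alpha> \<pi>\<^sub>0 q v x c \<longleftrightarrow> c = q x + risk (\<alpha> - 1) (\<pi>\<^sub>0 x) v"
proof -
  have "tilted_pmf (\<pi>\<^sub>0 x) v \<in> controls \<alpha> \<pi>\<^sub>0 x"
    by (simp add: controls_def renyi_well_defined_def set_tilted_pmf set_pmf_not_empty)
  then have "is_minimum ((\<lambda>u. renyi \<alpha> (\<pi>\<^sub>0 x) u + risk \<alpha> u v) ` controls \<alpha> \<pi>\<^sub>0 x)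
      (risk (\<alpha> - 1) (\<pi>\<^sub>0 x) v)"
    unfolding is_minimum_def
    by (auto simp: controls_def renyi_risk_lower_bound renyi_risk_tilted
        intro: rev_image_eqI)
  then show ?thesis
    unfolding bellman_step_def by (simp add: is_minimum_unique)
qed

lemma bellman_step_1: "bellman_step 1 \<pi>\<^sub>0 q v x c \<longleftrightarrow> c = q x + expect (\<pi>\<^sub>0 x) v"
  by (simp add: bellman_step_iff risk_def)

text \<open>Multiplying by \<open>\<alpha> - 1\<close> and exponentiating undoes the scaled
  logarithm in \<open>risk\<close>. As \<alpha> - 1 is nonzero, this is injective in
  \<open>c\<close>, so an equivalence results.\<close>

lemma bellman_step_exp:
  assumes "\<alpha> \<noteq> 1"
  shows "bellman_step \<alpha> \<pi>\<^sub>0 q v x c \<longleftrightarrow>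
    exp ((\<alpha> - 1) * c) = exp ((\<alpha> - 1) * q x) * expect (\<pi>\<^sub>0 x) (\<lambda>y. exp ((\<alpha> - 1) * v y))"
proof -
  define E where "E = expect (\<pi>\<^sub>0 x) (\<lambda>y. exp ((\<alpha> - 1) * v y))"
  have E: "0 < E"
    unfolding E_def by (rule expect_pos) simp
  have "exp ((\<alpha> - 1) * q x) * E = exp ((\<alpha> - 1) * (q x + risk (\<alpha> - 1) (\<pi>\<^sub>0 x) v))"
    using assms E by (simp add: risk_def distrib_left exp_add flip: E_def)
  then show ?thesis
    using assms by (simp add: bellman_step_iff flip: E_def)
qed

section \<open>The linear equations\<close>

text \<open>Positivity is what permits the return from \<open>z\<close> to
  \<open>v = ln z / (\<alpha> - 1)\<close>; the remaining conditions form a linear recursion. Times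
  after \<open>T\<close> stay unconstrained.\<close>

lemma fh_optimal_z_iff:
  assumes "\<alpha> \<noteq> 1"
  shows "fh_optimal_z \<alpha> \<pi>\<^sub>0 T q q\<^sub>f z \<longleftrightarrow>
    (\<forall>t\<le>T. \<forall>x. 0 < z t x) \<and> (\<forall>x. z T x = exp ((\<alpha> - 1) * q\<^sub>f x)) \<and>
    (\<forall>t<T. \<forall>x. z t x = exp ((\<alpha> - 1) * q x) * expect (\<pi>\<^sub>0 x) (z (Suc t)))"
    (is "?L \<longleftrightarrow> ?R")
proof
  assume ?L
  then obtain v where v: "\<And>x. v T x = q\<^sub>f x"
      "\<And>t x. t < T \<Longrightarrow> bellman_step \<alpha> \<pi>\<^sub>0 q (v (Suc t)) x (v t x)"
    and z: "\<And>t x. t \<le> T \<Longrightarrow> z t x = exp ((\<alpha> - 1) * v t x)"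
    unfolding fh_optimal_z_def fh_optimal_value_def by metis
  have "z t x = exp ((\<alpha> - 1) * q x) * expect (\<pi>\<^sub>0 x) (z (Suc t))" if "t < T" for t x
  proof -
    \<comment> \<open>Rewriting under \<open>expect\<close> needs equality of functions, available
      at \<open>Suc t\<close> because t < T.\<close>
    have "z (Suc t) = (\<lambda>y. exp ((\<alpha> - 1) * v (Suc t) y))"
      using that z by auto
    then show ?thesis
      using v(2)[OF that, of x] z[of t x] that assms by (simp add: bellman_step_exp)
  qed
  then show ?R
    using v(1) z by simp
next
  assume R: ?R
  define v where "v t x = ln (z t x) / (\<alpha> - 1)" for t x
  have z: "exp ((\<alpha> - 1) * v t x) = z t x" if "t \<le> T" for t x
    using R that assms by (simp add: v_def)
  have "v T x = q\<^sub>f x" for x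
    using R assms by (simp add: v_def)
  moreover have "bellman_step \<alpha> \<pi>\<^sub>0 q (v (Suc t)) x (v t x)" if "t < T" for t x
    using R that by (simp add: bellman_step_exp[OF assms] z)
  ultimately show ?L
    unfolding fh_optimal_z_def fh_optimal_value_def using z by metis
qed

lemma fe_optimal_value_exp:
  assumes "\<alpha> \<noteq> 1"
  shows "fe_optimal_value \<alpha> \<pi>\<^sub>0 Term q q\<^sub>f v \<longleftrightarrow>
    (\<forall>x\<in>Term. exp ((\<alpha> - 1) * v x) = exp ((\<alpha> - 1) * q\<^sub>f x)) \<and>
    (\<forall>x\<in>- Term. exp ((\<alpha> - 1) * v x) =
       exp ((\<alpha> - 1) * q x) * expect (\<pi>\<^sub>0 x) (\<lambda>y. exp ((\<alpha> - 1) * v y)))"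
  using assms by (simp add: fe_optimal_value_def bellman_step_exp)

text \<open>The logarithm again inverts the substitution on positive functions, leaving a linear
  boundary value problem with data prescribed on \<open>Term\<close>.\<close>

lemma fe_optimal_z_iff:
  assumes "\<alpha> \<noteq> 1"
  shows "fe_optimal_z \<alpha> \<pi>\<^sub>0 Term q q\<^sub>f z \<longleftrightarrow>
    (\<forall>x. 0 < z x) \<and> (\<forall>x\<in>Term. z x = exp ((\<alpha> - 1) * q\<^sub>f x)) \<and>
    (\<forall>x\<in>- Term. z x = exp ((\<alpha> - 1) * q x) * expect (\<pi>\<^sub>0 x) z)"
    (is "?L \<longleftrightarrow> ?R")
proof
  assume ?L
  then obtain v where v: "fe_optimal_value \<alpha> \<pi>\<^sub>0 Term q q\<^sub>f v"
    and z: "z = (\<lambda>x. exp ((\<alpha> - 1) * v x))"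
    by (auto simp: fe_optimal_z_def)
  then show ?R
    using assms by (simp add: fe_optimal_value_exp)
next
  assume R: ?R
  define v where "v x = ln (z x) / (\<alpha> - 1)" for x
  have z: "exp ((\<alpha> - 1) * v x) = z x" for x
    using R assms by (simp add: v_def)
  show ?L
    unfolding fe_optimal_z_def using R
    by (intro exI[of _ v]) (simp add: fe_optimal_value_exp[OF assms] z)
qed

text \<open>The map from \<open>v\<close> to its exponential is injective and carries the optimal
  values onto the optimal \<open>z\<close>, so uniqueness can be argued in the linear
  problem.\<close>

lemma fe_unique_iff_z:
  assumes "\<alpha> \<noteq> 1"
  shows "fe_unique \<alpha> \<pi>\<^sub>0 Term q q\<^sub>f \<longleftrightarrow> (\<exists>!z. fe_optimal_z \<alpha> \<pi>\<^sub>0 Term q q\<^sub>f z)"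
proof -
  let ?Z = "\<lambda>v x. exp ((\<alpha> - 1) * v x)"
  have opt: "fe_optimal_z \<alpha> \<pi>\<^sub>0 Term q q\<^sub>f z \<longleftrightarrow> (\<exists>v. fe_optimal_value \<alpha> \<pi>\<^sub>0 Term q q\<^sub>f v \<and> z = ?Z v)"
    for z
    by (auto simp: fe_optimal_z_def fun_eq_iff)
  have "inj ?Z"
    using assms by (auto simp: inj_def fun_eq_iff)
  then show ?thesis
    unfolding fe_unique_def opt Ex1_def by (auto dest: injD)
qed

section \<open>Transfer of first-exit uniqueness\<close>

lemma fe_optimal_value_1_iff:
  "fe_optimal_value 1 \<pi>\<^sub>0 Term q q\<^sub>f v \<longleftrightarrow>
    (\<forall>x\<in>Term. v x = q\<^sub>f x) \<and> (\<forall>x\<in>- Term. v x = q x + expect (\<pi>\<^sub>0 x) v)"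
  by (simp add: fe_optimal_value_def bellman_step_1)

text \<open>Neither cost occurs in the homogeneous equation satisfied by the difference of two
  solutions. Adding that difference to the solution \<open>r\<close> of the uniquely solvable
  problem yields a solution again, so the difference is zero.\<close>

lemma fe_unique_1_transfer:
  assumes uniq: "fe_unique 1 \<pi>\<^sub>0 Term q q\<^sub>f" and v: "fe_optimal_value 1 \<pi>\<^sub>0 Term q' q\<^sub>f' v"
  shows "fe_unique 1 \<pi>\<^sub>0 Term q' q\<^sub>f'"
  unfolding fe_unique_def
proof (rule ex1I)
  show "fe_optimal_value 1 \<pi>\<^sub>0 Term q' q\<^sub>f' v"
    by (rule v)
next
  fix v' assume v': "fe_optimal_value 1 \<pi>\<^sub>0 Term q' q\<^sub>f' v'"
  obtain r where r: "fe_optimal_value 1 \<pi>\<^sub>0 Term q q\<^sub>f r"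
    using uniq by (auto simp: fe_unique_def)
  have "fe_optimal_value 1 \<pi>\<^sub>0 Term q q\<^sub>f (\<lambda>x. r x + (v' x - v x))"
    using r v v' by (auto simp: fe_optimal_value_1_iff expect_add expect_diff)
  then have "(\<lambda>x. r x + (v' x - v x)) = r"
    using uniq r by (auto simp: fe_unique_def)
  then show "v' = v"
    by (simp add: fun_eq_iff)
qed

text \<open>Finiteness gives a positive minimum \<open>m\<close> of \<open>r\<close> and a bound
  \<open>M\<close> on the absolute values of \<open>d\<close>. The choice
  \<open>e = m / (M + 1)\<close> works, the \<open>+ 1\<close> covering \<open>M = 0\<close> and
  making the estimate strict.\<close>

lemma small_perturbation_pos:
  fixes r d :: "'x::finite \<Rightarrow> real"
  assumes "\<And>x. 0 < r x"
  obtains e where "0 < e" "\<And>x. 0 < r x + e * d x"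
proof -
  define m where "m = Min (range r)"
  define M where "M = Max (range (\<lambda>x. \<bar>d x\<bar>))"
  have m: "0 < m" "m \<le> r x" for x
    using assms by (simp_all add: m_def)
  have M: "\<bar>d x\<bar> \<le> M" for x
    by (simp add: M_def)
  \<comment> \<open>\<open>undefined\<close> is just some state, at which \<open>M\<close> bounds an
    absolute value.\<close>
  have M0: "0 \<le> M"
    using M[of undefined] by linarith
  have "0 < r x + m / (M + 1) * d x" for x
  proof -
    have "m / (M + 1) * \<bar>d x\<bar> \<le> m / (M + 1) * M"
      using M m M0 by (intro mult_left_mono) auto
    also have "\<dots> < m"
      using m M0 by (simp add: field_simps)
    finally have "\<bar>m / (M + 1) * d x\<bar> < m"
      using m M0 by (simp add: abs_mult)
    then show ?thesis
      using m(2)[of x] unfolding abs_less_iff by linarith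
  qed
  then show ?thesis
    using m M0 by (intro that[of "m / (M + 1)"]) auto
qed

text \<open>The homogeneous equation for \<open>z\<close> still contains
  \<open>exp ((\<alpha> - 1) * q x)\<close>, so both problems share \<open>q\<close>. Adding the
  full difference could destroy positivity, hence the small factor \<open>e\<close>; as
  \<open>e\<close> is nonzero, \<open>z' = z\<close> follows.\<close>

lemma fe_unique_z_transfer:
  assumes "\<alpha> \<noteq> 1"
    and uniq: "fe_unique \<alpha> \<pi>\<^sub>0 Term q q\<^sub>f" and z: "fe_optimal_z \<alpha> \<pi>\<^sub>0 Term q q\<^sub>f' z"
  shows "fe_unique \<alpha> \<pi>\<^sub>0 Term q q\<^sub>f'"
  unfolding fe_unique_iff_z[OF assms(1)]
proof (rule ex1I)
  show "fe_optimal_z \<alpha> \<pi>\<^sub>0 Term q q\<^sub>f' z"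
    by (rule z)
next
  fix z' assume z': "fe_optimal_z \<alpha> \<pi>\<^sub>0 Term q q\<^sub>f' z'"
  have uniq': "\<exists>!z. fe_optimal_z \<alpha> \<pi>\<^sub>0 Term q q\<^sub>f z"
    using uniq assms(1) by (simp add: fe_unique_iff_z)
  then obtain r where r: "fe_optimal_z \<alpha> \<pi>\<^sub>0 Term q q\<^sub>f r"
    by blast
  then have "\<And>x. 0 < r x"
    using assms(1) by (simp add: fe_optimal_z_iff)
  then obtain e where e: "0 < e" "\<And>x. 0 < r x + e * (z' x - z x)"
    using small_perturbation_pos[of r "\<lambda>x. z' x - z x"] by blast
  have "fe_optimal_z \<alpha> \<pi>\<^sub>0 Term q q\<^sub>f (\<lambda>x. r x + e * (z' x - z x))"
    using r z z' e(2)
    by (simp add: fe_optimal_z_iff[OF assms(1)] expect_add expect_diff expect_cmult algebra_simps)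
  then have "(\<lambda>x. r x + e * (z' x - z x)) = r"
    using uniq' r by blast
  then show "z' = z"
    using e(1) by (simp add: fun_eq_iff)
qed

section \<open>Superposition of solutions\<close>

lemma sum_weighted_pos:
  fixes w f :: "'i \<Rightarrow> real"
  assumes "finite I" "\<And>i. i \<in> I \<Longrightarrow> 0 \<le> w i" "\<exists>i\<in>I. w i \<noteq> 0" "\<And>i. i \<in> I \<Longrightarrow> 0 < f i"
  shows "0 < (\<Sum>i\<in>I. w i * f i)"
proof -
  obtain j where "j \<in> I" "w j \<noteq> 0"
    using assms(3) by blast
  then show ?thesis
    using assms by (intro sum_pos2[of I j]) (auto simp: less_le)
qed

text \<open>Apart from positivity the characterising conditions are linear in \<open>z\<close>. One
  nonzero weight keeps the combination positive and also lets \<open>exp\<close> undo the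
  \<open>ln\<close> in the composite final cost.\<close>

lemma fh_optimal_z_sum:
  assumes "\<alpha> \<noteq> 1" "finite I" "\<And>i. i \<in> I \<Longrightarrow> 0 \<le> w i" "\<exists>i\<in>I. w i \<noteq> 0"
    and z: "\<And>i. i \<in> I \<Longrightarrow> fh_optimal_z \<alpha> \<pi>\<^sub>0 T q (q\<^sub>f i) (z i)"
  shows "fh_optimal_z \<alpha> \<pi>\<^sub>0 T q
    (\<lambda>x. 1 / (\<alpha> - 1) * ln (\<Sum>i\<in>I. w i * exp ((\<alpha> - 1) * q\<^sub>f i x))) (\<lambda>t x. \<Sum>i\<in>I. w i * z i t x)"
proof -
  note pos = sum_weighted_pos[OF assms(2-4)]
  note z' = z[unfolded fh_optimal_z_iff[OF assms(1)]]
  have "0 < (\<Sum>i\<in>I. w i * exp ((\<alpha> - 1) * q\<^sub>f i x))" for x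
    by (intro pos exp_gt_zero)
  then have "(\<Sum>i\<in>I. w i * z i T x) =
      exp ((\<alpha> - 1) * (1 / (\<alpha> - 1) * ln (\<Sum>i\<in>I. w i * exp ((\<alpha> - 1) * q\<^sub>f i x))))" for x
    using assms(1) z' by simp
  moreover have "0 < (\<Sum>i\<in>I. w i * z i t x)" if "t \<le> T" for t x
    using z' that by (intro pos) auto
  moreover have "(\<Sum>i\<in>I. w i * z i t x) =
      exp ((\<alpha> - 1) * q x) * expect (\<pi>\<^sub>0 x) (\<lambda>x. \<Sum>i\<in>I. w i * z i (Suc t) x)" if "t < T" for t x
    unfolding expect_sum expect_cmult sum_distrib_left
    using z' that by (intro sum.cong) (auto simp: mult_ac)
  ultimately show ?thesis
    unfolding fh_optimal_z_iff[OF assms(1)] by blast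
qed

lemma fe_optimal_z_sum:
  assumes "\<alpha> \<noteq> 1" "finite I" "\<And>i. i \<in> I \<Longrightarrow> 0 \<le> w i" "\<exists>i\<in>I. w i \<noteq> 0"
    and z: "\<And>i. i \<in> I \<Longrightarrow> fe_optimal_z \<alpha> \<pi>\<^sub>0 Term q (q\<^sub>f i) (z i)"
  shows "fe_optimal_z \<alpha> \<pi>\<^sub>0 Term q
    (\<lambda>x. 1 / (\<alpha> - 1) * ln (\<Sum>i\<in>I. w i * exp ((\<alpha> - 1) * q\<^sub>f i x))) (\<lambda>x. \<Sum>i\<in>I. w i * z i x)"
proof -
  note pos = sum_weighted_pos[OF assms(2-4)]
  note z' = z[unfolded fe_optimal_z_iff[OF assms(1)]]
  have "0 < (\<Sum>i\<in>I. w i * exp ((\<alpha> - 1) * q\<^sub>f i x))" for x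
    by (intro pos exp_gt_zero)
  then have "(\<Sum>i\<in>I. w i * z i x) =
      exp ((\<alpha> - 1) * (1 / (\<alpha> - 1) * ln (\<Sum>i\<in>I. w i * exp ((\<alpha> - 1) * q\<^sub>f i x))))" if "x \<in> Term" for x
    using assms(1) z' that by simp
  moreover have "0 < (\<Sum>i\<in>I. w i * z i x)" for x
    using z' by (intro pos) auto
  moreover have "(\<Sum>i\<in>I. w i * z i x) =
      exp ((\<alpha> - 1) * q x) * expect (\<pi>\<^sub>0 x) (\<lambda>x. \<Sum>i\<in>I. w i * z i x)" if "x \<in> - Term" for x
  proof -
    have "w i * z i x = exp ((\<alpha> - 1) * q x) * (w i * expect (\<pi>\<^sub>0 x) (z i))" if "i \<in> I" for i
      using z'[OF that] \<open>x \<in> - Term\<close> by simp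
    then show ?thesis
      unfolding expect_sum expect_cmult sum_distrib_left by (intro sum.cong) auto
  qed
  ultimately show ?thesis
    unfolding fe_optimal_z_iff[OF assms(1)] by blast
qed

text \<open>For \<alpha> = 1 the recursion is affine with inhomogeneity \<open>q\<close>, so running
  costs combine with the same weights as values and final costs.\<close>

lemma fh_optimal_value_1_sum:
  assumes "\<And>i. i \<in> I \<Longrightarrow> fh_optimal_value 1 \<pi>\<^sub>0 T (q i) (q\<^sub>f i) (v i)"
  shows "fh_optimal_value 1 \<pi>\<^sub>0 T (\<lambda>x. \<Sum>i\<in>I. w i * q i x) (\<lambda>x. \<Sum>i\<in>I. w i * q\<^sub>f i x)
    (\<lambda>t x. \<Sum>i\<in>I. w i * v i t x)"
  using assms
  by (simp add: fh_optimal_value_def bellman_step_1 expect_sum expect_cmult distrib_left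
      flip: sum.distrib)

lemma fe_optimal_value_1_sum:
  assumes "\<And>i. i \<in> I \<Longrightarrow> fe_optimal_value 1 \<pi>\<^sub>0 Term (q i) (q\<^sub>f i) (v i)"
  shows "fe_optimal_value 1 \<pi>\<^sub>0 Term (\<lambda>x. \<Sum>i\<in>I. w i * q i x) (\<lambda>x. \<Sum>i\<in>I. w i * q\<^sub>f i x)
    (\<lambda>x. \<Sum>i\<in>I. w i * v i x)"
proof -
  note v = assms[unfolded fe_optimal_value_1_iff]
  have "w i * v i x = w i * q i x + w i * expect (\<pi>\<^sub>0 x) (v i)" if "i \<in> I" "x \<in> - Term" for i x
    using v[OF that(1)] that(2) by (metis distrib_left)
  then show ?thesis
    using v by (simp add: fe_optimal_value_1_iff expect_sum expect_cmult flip: sum.distrib)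
qed

text \<open>Some weight must be nonzero if \<open>\<alpha> \<noteq> 1\<close>, since the zero
  function is not an exponential. A first-exit equation may fail to determine its solution, so the
  \<open>fe_unique\<close> clauses add that well-posedness passes to the composite problem.\<close>

theorem theorem3:
  fixes \<alpha> :: real
    and \<pi>\<^sub>0 :: "'x::finite \<Rightarrow> 'x pmf"
    and k :: nat
    and w :: "nat \<Rightarrow> real"
    and q\<^sub>f :: "nat \<Rightarrow> 'x \<Rightarrow> real"
  assumes "k \<ge> 1"
    and "\<forall>i\<in>{1..k}. 0 \<le> w i"
  shows
    "(\<alpha> \<noteq> 1 \<longrightarrow> (\<exists>i\<in>{1..k}. w i \<noteq> 0) \<longrightarrow>
       (\<forall>T q z.
          (\<forall>i\<in>{1..k}. fh_optimal_z \<alpha> \<pi>\<^sub>0 T q (q\<^sub>f i) (z i)) \<longrightarrow>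
          fh_optimal_z \<alpha> \<pi>\<^sub>0 T q
            (\<lambda>x. 1 / (\<alpha> - 1) * ln (\<Sum>i=1..k. w i * exp ((\<alpha> - 1) * q\<^sub>f i x)))
            (\<lambda>t x. \<Sum>i=1..k. w i * z i t x)) \<and>
       (\<forall>Term q z.
          (\<forall>i\<in>{1..k}. fe_optimal_z \<alpha> \<pi>\<^sub>0 Term q (q\<^sub>f i) (z i)) \<longrightarrow>
          fe_optimal_z \<alpha> \<pi>\<^sub>0 Term q
            (\<lambda>x. 1 / (\<alpha> - 1) * ln (\<Sum>i=1..k. w i * exp ((\<alpha> - 1) * q\<^sub>f i x)))
            (\<lambda>x. \<Sum>i=1..k. w i * z i x) \<and>
          ((\<forall>i\<in>{1..k}. fe_unique \<alpha> \<pi>\<^sub>0 Term q (q\<^sub>f i)) \<longrightarrow>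
           fe_unique \<alpha> \<pi>\<^sub>0 Term q
            (\<lambda>x. 1 / (\<alpha> - 1) * ln (\<Sum>i=1..k. w i * exp ((\<alpha> - 1) * q\<^sub>f i x)))))) \<and>
     (\<alpha> = 1 \<longrightarrow>
       (\<forall>T q v.
          (\<forall>i\<in>{1..k}. fh_optimal_value \<alpha> \<pi>\<^sub>0 T (q i) (q\<^sub>f i) (v i)) \<longrightarrow>
          fh_optimal_value \<alpha> \<pi>\<^sub>0 T
            (\<lambda>x. \<Sum>i=1..k. w i * q i x)
            (\<lambda>x. \<Sum>i=1..k. w i * q\<^sub>f i x)
            (\<lambda>t x. \<Sum>i=1..k. w i * v i t x)) \<and>
       (\<forall>Term q v.
          (\<forall>i\<in>{1..k}. fe_optimal_value \<alpha> \<pi>\<^sub>0 Term (q i) (q\<^sub>f i) (v i)) \<longrightarrow>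
          fe_optimal_value \<alpha> \<pi>\<^sub>0 Term
            (\<lambda>x. \<Sum>i=1..k. w i * q i x)
            (\<lambda>x. \<Sum>i=1..k. w i * q\<^sub>f i x)
            (\<lambda>x. \<Sum>i=1..k. w i * v i x) \<and>
          ((\<forall>i\<in>{1..k}. fe_unique \<alpha> \<pi>\<^sub>0 Term (q i) (q\<^sub>f i)) \<longrightarrow>
           fe_unique \<alpha> \<pi>\<^sub>0 Term
            (\<lambda>x. \<Sum>i=1..k. w i * q i x)
            (\<lambda>x. \<Sum>i=1..k. w i * q\<^sub>f i x))))"
proof -
  \<comment> \<open>Uniqueness is transferred from one component problem; the first serves.\<close>
  have one: "1 \<in> {1..k}"
    using assms(1) by simp
  have w: "\<And>i. i \<in> {1..k} \<Longrightarrow> 0 \<le> w i"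
    using assms(2) by blast
  show ?thesis
  proof (intro conjI impI allI)
    fix T q and z :: "nat \<Rightarrow> nat \<Rightarrow> 'x \<Rightarrow> real"
    assume "\<alpha> \<noteq> 1" "\<exists>i\<in>{1..k}. w i \<noteq> 0" "\<forall>i\<in>{1..k}. fh_optimal_z \<alpha> \<pi>\<^sub>0 T q (q\<^sub>f i) (z i)"
    then show "fh_optimal_z \<alpha> \<pi>\<^sub>0 T q
        (\<lambda>x. 1 / (\<alpha> - 1) * ln (\<Sum>i=1..k. w i * exp ((\<alpha> - 1) * q\<^sub>f i x)))
        (\<lambda>t x. \<Sum>i=1..k. w i * z i t x)"
      by (intro fh_optimal_z_sum w) auto
  next
    fix Term q and z :: "nat \<Rightarrow> 'x \<Rightarrow> real"
    assume \<alpha>: "\<alpha> \<noteq> 1" and "\<exists>i\<in>{1..k}. w i \<noteq> 0"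
      and "\<forall>i\<in>{1..k}. fe_optimal_z \<alpha> \<pi>\<^sub>0 Term q (q\<^sub>f i) (z i)"
    then show z: "fe_optimal_z \<alpha> \<pi>\<^sub>0 Term q
        (\<lambda>x. 1 / (\<alpha> - 1) * ln (\<Sum>i=1..k. w i * exp ((\<alpha> - 1) * q\<^sub>f i x)))
        (\<lambda>x. \<Sum>i=1..k. w i * z i x)"
      by (intro fe_optimal_z_sum w) auto
    assume "\<forall>i\<in>{1..k}. fe_unique \<alpha> \<pi>\<^sub>0 Term q (q\<^sub>f i)"
    then show "fe_unique \<alpha> \<pi>\<^sub>0 Term q
        (\<lambda>x. 1 / (\<alpha> - 1) * ln (\<Sum>i=1..k. w i * exp ((\<alpha> - 1) * q\<^sub>f i x)))"
      using fe_unique_z_transfer[OF \<alpha> _ z] one by blast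
  next
    fix T q and v :: "nat \<Rightarrow> nat \<Rightarrow> 'x \<Rightarrow> real"
    assume "\<alpha> = 1" "\<forall>i\<in>{1..k}. fh_optimal_value \<alpha> \<pi>\<^sub>0 T (q i) (q\<^sub>f i) (v i)"
    then show "fh_optimal_value \<alpha> \<pi>\<^sub>0 T (\<lambda>x. \<Sum>i=1..k. w i * q i x)
        (\<lambda>x. \<Sum>i=1..k. w i * q\<^sub>f i x) (\<lambda>t x. \<Sum>i=1..k. w i * v i t x)"
      using fh_optimal_value_1_sum[of "{1..k}" \<pi>\<^sub>0 T q q\<^sub>f v w] by simp
  next
    fix Term q and v :: "nat \<Rightarrow> 'x \<Rightarrow> real"
    assume \<alpha>: "\<alpha> = 1" and "\<forall>i\<in>{1..k}. fe_optimal_value \<alpha> \<pi>\<^sub>0 Term (q i) (q\<^sub>f i) (v i)"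
    then show v: "fe_optimal_value \<alpha> \<pi>\<^sub>0 Term (\<lambda>x. \<Sum>i=1..k. w i * q i x)
        (\<lambda>x. \<Sum>i=1..k. w i * q\<^sub>f i x) (\<lambda>x. \<Sum>i=1..k. w i * v i x)"
      using fe_optimal_value_1_sum[of "{1..k}" \<pi>\<^sub>0 Term q q\<^sub>f v w] by simp
    assume "\<forall>i\<in>{1..k}. fe_unique \<alpha> \<pi>\<^sub>0 Term (q i) (q\<^sub>f i)"
    then show "fe_unique \<alpha> \<pi>\<^sub>0 Term (\<lambda>x. \<Sum>i=1..k. w i * q i x) (\<lambda>x. \<Sum>i=1..k. w i * q\<^sub>f i x)"
      using fe_unique_1_transfer[OF _ v[unfolded \<alpha>]] one \<alpha> by blast
  qed
qed

end
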